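(* Let $k,N$ be integers with $1\le k\le N-1$, and let $D_{\mathsf A}(k,N-k)$ be the edge-colored directed graph of the Domino Game on $k\times(N-k)$ partitions, with edges colored by $[N-1]=\{1,\dots,N-1\}$. Then $D_{\mathsf A}(k,N-k)$ is the order diagram (Hasse diagram, edges directed upward) of a diamond-colored distributive lattice.
   Context: A $k\times(N-k)$ partition is an integer sequence $\sigma=(\sigma_1,\dots,\sigma_k)$ with $N-k\ge\sigma_1\ge\sigma_2\ge\cdots\ge\sigma_k\ge0$. It is identified with the left-justified shape having $\sigma_r$ boxes in row $r$ of a board with $k$ rows (numbered from top) and $N-k$ columns (numbered from left). The board is colored checkerboard-style with the upper right square $(1,N-k)$ red; that is, square $(r,c)$ is red iff $r+c\equiv 1+N-k \pmod 2$, and is white otherwise. Vertices of $D_{\mathsf A}(k,N-k)$: all $k\times(N-k)$ partitions. Directed edges: $\sigma\to\tau$ iff $\tau$ is obtained from $\sigma$ by one of the following moves (both $\sigma$ and $\tau$ being $k\times (N-k)$ partitions): (i) removing from $\sigma$ either a horizontal domino (two horizontally adjacent squares) whose left square is red and right square is white, or a vertical domino (two vertically adjacent squares) whose top square is white and bottom square is red, or the single (red) square in the upper right corner $(1,N-k)$ of the board; (ii) adding to $\sigma$ either a horizontal domino whose left square is white and right square is red, or a vertical domino whose top square is red and bottom square is white. Edge colors: for a partition $\sigma$ put $S(\sigma)=\{\sigma_j+k-j+1 : 1\le j\le k\}\subseteq\{1,\dots,N\}$. For $1\le i\le N-1$ define a pair $(x_i,y_i)$ as follows. If $N$ is even: $(x_i,y_i)=(2i-1,2i+1)$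 for $1\le i<N/2$; $(2i-1,2i)$ for $i=N/2$; $(2N-2i+2,2N-2i)$ for $N/2<i\le N-1$. If $N$ is odd: $(x_i,y_i)=(2i,2i+2)$ for $1\le i<\lfloor N/2\rfloor$; $(2i,2i+1)$ for $i=\lfloor N/2\rfloor$; $(2N-2i+1,2N-2i-1)$ for $\lceil N/2\rceil\le i\le N-1$. An edge $\sigma\to\tau$ has color $i$ iff $x_i\in S(\tau)$, $y_i\notin S(\tau)$ and $S(\sigma)=(S(\tau)\setminus\{x_i\})\cup\{y_i\}$. All posets are finite. The order diagram of a poset has a directed edge $\mathbf x\to\mathbf y$ iff $\mathbf y$ covers $\mathbf x$. A poset whose order diagram has colored edges is diamond-colored if, whenever $\mathbf v\to\mathbf s$, $\mathbf v\to\mathbf t$, $\mathbf s\to\mathbf u$, $\mathbf t\to\mathbf u$ with $\mathbf s\neq\mathbf t$, opposite edges have the same color: $\mathbf v\to\mathbf s$ and $\mathbf t\to\mathbf u$ have the same color, and $\mathbf v\to\mathbf t$ and $\mathbf s\to\mathbf u$ have the same color. A diamond-colored distributive lattice is a distributive lattice whose order diagram is edge-colored with this property. *)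

theory Defs
  imports "HOL-Algebra.Lattice"
begin

section \<open>Diamond-colored distributive lattices\<close>

record ('v, 'c) colored_digraph =
  vertices :: "'v set"
  edges :: "('v \<times> 'v) set"
  has_color :: "'v \<Rightarrow> 'v \<Rightarrow> 'c \<Rightarrow> bool"

definition edge_colored_by :: "('v, 'c) colored_digraph \<Rightarrow> 'c set \<Rightarrow> bool" where
  "edge_colored_by G C \<longleftrightarrow>
     edges G \<subseteq> vertices G \<times> vertices G \<and>
     (\<forall>(x, y) \<in> edges G. \<exists>i\<in>C. \<forall>j. has_color G x y j \<longleftrightarrow> j = i)"

definition diamond_colored :: "('v, 'c) colored_digraph \<Rightarrow> bool" where
  "diamond_colored G \<longleftrightarrow>
     (\<forall>v s t u. (v, s) \<in> edges G \<and> (v, t) \<in> edges G \<and>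
        (s, u) \<in> edges G \<and> (t, u) \<in> edges G \<and> s \<noteq> t \<longrightarrow>
        (\<forall>i. has_color G v s i \<longleftrightarrow> has_color G t u i) \<and>
        (\<forall>i. has_color G v t i \<longleftrightarrow> has_color G s u i))"

locale distributive_lattice = lattice L for L (structure) +
  assumes meet_join_distrib:
    "\<lbrakk>x \<in> carrier L; y \<in> carrier L; z \<in> carrier L\<rbrakk> \<Longrightarrow>
       x \<sqinter> (y \<squnion> z) = (x \<sqinter> y) \<squnion> (x \<sqinter> z)"

definition covers :: "('a, 'm) gorder_scheme \<Rightarrow> 'a \<Rightarrow> 'a \<Rightarrow> bool" where
  "covers L y x \<longleftrightarrow> x \<in> carrier L \<and> y \<in> carrier L \<and> x \<sqsubset>\<^bsub>L\<^esub> y \<and>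
     \<not> (\<exists>z\<in>carrier L. x \<sqsubset>\<^bsub>L\<^esub> z \<and> z \<sqsubset>\<^bsub>L\<^esub> y)"

definition is_order_diagram_of ::
  "('v, 'c) colored_digraph \<Rightarrow> ('v, 'm) gorder_scheme \<Rightarrow> bool" where
  "is_order_diagram_of G L \<longleftrightarrow>
     vertices G = carrier L \<and> edges G = {(x, y). covers L y x}"

section \<open>The Domino Game\<close>

text \<open>Rows and columns are numbered from 1, as are the parts of a partition; lists are
  indexed from 0.\<close>

definition board_partitions :: "nat \<Rightarrow> nat \<Rightarrow> nat list set" where
  "board_partitions k N =
     {\<sigma>. length \<sigma> = k \<and> sorted_wrt (\<ge>) \<sigma> \<and> (\<forall>p\<in>set \<sigma>. p \<le> N - k)}"

definition part :: "nat list \<Rightarrow> nat \<Rightarrow> nat" where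
  "part \<sigma> j = \<sigma> ! (j - 1)"

definition shape :: "nat list \<Rightarrow> (nat \<times> nat) set" where
  "shape \<sigma> = {(r, c). 1 \<le> r \<and> r \<le> length \<sigma> \<and> 1 \<le> c \<and> c \<le> part \<sigma> r}"

definition red :: "nat \<Rightarrow> nat \<Rightarrow> nat \<times> nat \<Rightarrow> bool" where
  "red k N = (\<lambda>(r, c). (r + c) mod 2 = (1 + (N - k)) mod 2)"

abbreviation white :: "nat \<Rightarrow> nat \<Rightarrow> nat \<times> nat \<Rightarrow> bool" where
  "white k N sq \<equiv> \<not> red k N sq"

definition removes :: "nat list \<Rightarrow> nat list \<Rightarrow> (nat \<times> nat) set \<Rightarrow> bool" where
  "removes \<sigma> \<tau> X \<longleftrightarrow> X \<subseteq> shape \<sigma> \<and> shape \<tau> = shape \<sigma> - X"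

definition adds :: "nat list \<Rightarrow> nat list \<Rightarrow> (nat \<times> nat) set \<Rightarrow> bool" where
  "adds \<sigma> \<tau> X \<longleftrightarrow> X \<inter> shape \<sigma> = {} \<and> shape \<tau> = shape \<sigma> \<union> X"

definition removal_move :: "nat \<Rightarrow> nat \<Rightarrow> nat list \<Rightarrow> nat list \<Rightarrow> bool" where
  "removal_move k N \<sigma> \<tau> \<longleftrightarrow>
     (\<exists>r c. red k N (r, c) \<and> white k N (r, c + 1) \<and> removes \<sigma> \<tau> {(r, c), (r, c + 1)}) \<or>
     (\<exists>r c. white k N (r, c) \<and> red k N (r + 1, c) \<and> removes \<sigma> \<tau> {(r, c), (r + 1, c)}) \<or>
     removes \<sigma> \<tau> {(1, N - k)}"

definition addition_move :: "nat \<Rightarrow> nat \<Rightarrow> nat list \<Rightarrow> nat list \<Rightarrow> bool" where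
  "addition_move k N \<sigma> \<tau> \<longleftrightarrow>
     (\<exists>r c. white k N (r, c) \<and> red k N (r, c + 1) \<and> adds \<sigma> \<tau> {(r, c), (r, c + 1)}) \<or>
     (\<exists>r c. red k N (r, c) \<and> white k N (r + 1, c) \<and> adds \<sigma> \<tau> {(r, c), (r + 1, c)})"

definition S_set :: "nat \<Rightarrow> nat list \<Rightarrow> nat set" where
  "S_set k \<sigma> = {part \<sigma> j + k - j + 1 | j. 1 \<le> j \<and> j \<le> k}"

text \<open>The subtractions below do not truncate in the range \<open>1 \<le> i \<le> N - 1\<close>. For odd \<open>N\<close>,
  \<open>\<lfloor>N/2\<rfloor>\<close> is \<open>N div 2\<close>, and the last case is \<open>\<lceil>N/2\<rceil> \<le> i\<close>.\<close>

definition color_pair :: "nat \<Rightarrow> nat \<Rightarrow> nat \<times> nat" where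
  "color_pair N i =
     (if even N then
        (if i < N div 2 then (2 * i - 1, 2 * i + 1)
         else if i = N div 2 then (2 * i - 1, 2 * i)
         else (2 * N - 2 * i + 2, 2 * N - 2 * i))
      else
        (if i < N div 2 then (2 * i, 2 * i + 2)
         else if i = N div 2 then (2 * i, 2 * i + 1)
         else (2 * N - 2 * i + 1, 2 * N - 2 * i - 1)))"

definition domino_color :: "nat \<Rightarrow> nat \<Rightarrow> nat list \<Rightarrow> nat list \<Rightarrow> nat \<Rightarrow> bool" where
  "domino_color k N \<sigma> \<tau> i \<longleftrightarrow> i \<in> {1..N - 1} \<and>
     (let (x, y) = color_pair N i in
        x \<in> S_set k \<tau> \<and> y \<notin> S_set k \<tau> \<and> S_set k \<sigma> = (S_set k \<tau> - {x}) \<union> {y})"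

text \<open>\<open>domino_digraph k N\<close> is $D_{\mathsf{A}}(k, N-k)$.\<close>

definition domino_digraph :: "nat \<Rightarrow> nat \<Rightarrow> (nat list, nat) colored_digraph" where
  "domino_digraph k N =
     \<lparr>vertices = board_partitions k N,
      edges = {(\<sigma>, \<tau>). \<sigma> \<in> board_partitions k N \<and> \<tau> \<in> board_partitions k N \<and>
                 (removal_move k N \<sigma> \<tau> \<or> addition_move k N \<sigma> \<tau>)},
      has_color = domino_color k N\<rparr>"

end

theory Submission
  imports Defs
begin

text \<open>  A partition \<open>\<sigma>\<close> is determined by the \<open>k\<close>-subset \<open>S_set k \<sigma>\<close> of \<open>{1..N}\<close>. Read on
  subsets, every move of the game replaces one element: the two boxes of a domino lie on two
  neighbouring diagonals of the board, and adding or removing them moves one element of the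
  subset by 2; the corner box moves \<open>N\<close> to \<open>N - 1\<close>. The checkerboard coloring says in which
  direction: elements of the parity of \<open>N\<close> go up, the others go down. So all moves are steps
  along one and the same linear order of \<open>{1..N}\<close>, which climbs through the numbers of the parity
  of \<open>N\<close> up to \<open>N\<close>, turns to \<open>N - 1\<close> and descends through the other parity. The color of an
  edge is the place in this order, counted from its top, where the step occurs.

  Relabelling \<open>{1..N}\<close> along this order (\<open>chain\<close>), the digraph becomes that of the \<open>k\<close>-subsets of
  a chain in which one element is moved by one step. Counting, for every \<open>m\<close>, the elements that
  are at most \<open>m\<close> turns a subset into a lattice path, that is, a function with increments 0 or 1
  from 0 to \<open>k\<close>; an edge of color \<open>i\<close> raises the path by 1 at the point \<open>i\<close>. Lattice paths are
  closed under pointwise minimum and maximum, hence form a distributive lattice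
  (\<open>distributive_lattice_of_embedding\<close>), and whenever one path is below another, a single
  raise leads from the lower path to a path that is still below the upper one
  (\<open>lattice_paths_raise_below\<close>). So the covers are exactly the raises, and raises at
  two points commute, which is the diamond property.

  The work lies in the dictionary between boxes and subsets. It rests on \<open>mem_shape_iff\<close>: whether a
  box belongs to the shape is a comparison of its row with the counting function of the subset at
  its diagonal. The number of boxes on a diagonal is therefore an affine function of the count, and
  both kinds of domino are treated alike (\<open>domino_iff_replaces\<close>).\<close>

section \<open>Distributive lattices of functions\<close>

text \<open>  A family of elements of a distributive lattice that is closed under its infima and suprema has
  these as meets and joins in the induced order, so the distributive law is inherited.\<close>

lemma distributive_lattice_of_embedding:
  fixes h :: "'a \<Rightarrow> 'b::distrib_lattice"
  assumes inj: "inj_on h V"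
    and inf_closed: "\<And>a b. a \<in> h ` V \<Longrightarrow> b \<in> h ` V \<Longrightarrow> inf a b \<in> h ` V"
    and sup_closed: "\<And>a b. a \<in> h ` V \<Longrightarrow> b \<in> h ` V \<Longrightarrow> sup a b \<in> h ` V"
  shows "distributive_lattice \<lparr>carrier = V, eq = (=), le = \<lambda>x y. h x \<le> h y\<rparr>"
    (is "distributive_lattice ?L")
proof -
  interpret partial_order ?L
    by unfold_locales (auto dest: inj_onD[OF inj] intro: order_trans)
  have lub: "least ?L s (Upper ?L {x, y})"
    if "x \<in> V" "y \<in> V" "s \<in> V" "h s = sup (h x) (h y)" for x y s
    using that by (auto simp: least_def Upper_def)
  have glb: "greatest ?L s (Lower ?L {x, y})"
    if "x \<in> V" "y \<in> V" "s \<in> V" "h s = inf (h x) (h y)" for x y s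
    using that by (auto simp: greatest_def Lower_def)
  have sup_ex: "\<exists>s\<in>V. h s = sup (h x) (h y)" if "x \<in> V" "y \<in> V" for x y
    using sup_closed[of "h x" "h y"] that by (metis imageE imageI)
  have inf_ex: "\<exists>s\<in>V. h s = inf (h x) (h y)" if "x \<in> V" "y \<in> V" for x y
    using inf_closed[of "h x" "h y"] that by (metis imageE imageI)
  interpret lattice ?L
  proof unfold_locales
    fix x y assume "x \<in> carrier ?L" "y \<in> carrier ?L"
    then show "\<exists>s. least ?L s (Upper ?L {x, y})" "\<exists>s. greatest ?L s (Lower ?L {x, y})"
      using lub glb sup_ex inf_ex by (simp, metis)+
  qed
  have h_join: "x \<squnion>\<^bsub>?L\<^esub> y \<in> V \<and> h (x \<squnion>\<^bsub>?L\<^esub> y) = sup (h x) (h y)"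
    if xy: "x \<in> V" "y \<in> V" for x y
  proof -
    obtain s where "s \<in> V" "h s = sup (h x) (h y)" using sup_ex xy by blast
    moreover from this have "s = x \<squnion>\<^bsub>?L\<^esub> y"
      using least_unique[OF lub sup_of_two_least] xy by (simp add: join_def)
    ultimately show ?thesis by simp
  qed
  have h_meet: "x \<sqinter>\<^bsub>?L\<^esub> y \<in> V \<and> h (x \<sqinter>\<^bsub>?L\<^esub> y) = inf (h x) (h y)"
    if xy: "x \<in> V" "y \<in> V" for x y
  proof -
    obtain s where "s \<in> V" "h s = inf (h x) (h y)" using inf_ex xy by blast
    moreover from this have "s = x \<sqinter>\<^bsub>?L\<^esub> y"
      using greatest_unique[OF glb inf_of_two_greatest] xy by (simp add: meet_def)
    ultimately show ?thesis by simp
  qed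
  show ?thesis
  proof unfold_locales
    fix x y z assume "x \<in> carrier ?L" "y \<in> carrier ?L" "z \<in> carrier ?L"
    then show "x \<sqinter>\<^bsub>?L\<^esub> (y \<squnion>\<^bsub>?L\<^esub> z) = (x \<sqinter>\<^bsub>?L\<^esub> y) \<squnion>\<^bsub>?L\<^esub> (x \<sqinter>\<^bsub>?L\<^esub> z)"
      by (intro inj_onD[OF inj]) (simp_all add: h_join h_meet inf_sup_distrib1)
  qed
qed

section \<open>The lattice of lattice paths\<close>

definition lattice_paths :: "nat \<Rightarrow> nat \<Rightarrow> (nat \<Rightarrow> nat) set" where
  "lattice_paths k N =
     {g. g 0 = 0 \<and> (\<forall>j. g j \<le> g (Suc j) \<and> g (Suc j) \<le> Suc (g j)) \<and> (\<forall>j\<ge>N. g j = k)}"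

definition raise :: "nat \<Rightarrow> (nat \<Rightarrow> nat) \<Rightarrow> nat \<Rightarrow> nat" where
  "raise i g = g(i := Suc (g i))"

lemma lattice_paths_inf:
  assumes "g \<in> lattice_paths k N" "g' \<in> lattice_paths k N"
  shows "inf g g' \<in> lattice_paths k N"
proof -
  have "min (g j) (g' j) \<le> min (g (Suc j)) (g' (Suc j))"
    "min (g (Suc j)) (g' (Suc j)) \<le> Suc (min (g j) (g' j))" for j
  proof -
    have "g j \<le> g (Suc j)" "g (Suc j) \<le> Suc (g j)" "g' j \<le> g' (Suc j)" "g' (Suc j) \<le> Suc (g' j)"
      using assms by (auto simp: lattice_paths_def)
    then show "min (g j) (g' j) \<le> min (g (Suc j)) (g' (Suc j))"
      "min (g (Suc j)) (g' (Suc j)) \<le> Suc (min (g j) (g' j))" by linarith+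
  qed
  then show ?thesis
    using assms by (simp add: lattice_paths_def inf_nat_def)
qed

lemma lattice_paths_sup:
  assumes "g \<in> lattice_paths k N" "g' \<in> lattice_paths k N"
  shows "sup g g' \<in> lattice_paths k N"
proof -
  have "max (g j) (g' j) \<le> max (g (Suc j)) (g' (Suc j))"
    "max (g (Suc j)) (g' (Suc j)) \<le> Suc (max (g j) (g' j))" for j
  proof -
    have "g j \<le> g (Suc j)" "g (Suc j) \<le> Suc (g j)" "g' j \<le> g' (Suc j)" "g' (Suc j) \<le> Suc (g' j)"
      using assms by (auto simp: lattice_paths_def)
    then show "max (g j) (g' j) \<le> max (g (Suc j)) (g' (Suc j))"
      "max (g (Suc j)) (g' (Suc j)) \<le> Suc (max (g j) (g' j))" by linarith+
  qed
  then show ?thesis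
    using assms by (simp add: lattice_paths_def sup_nat_def)
qed

text \<open>  At the first place \<open>j\<close> where the paths differ, the lower one is flat and the upper one rises. The
  lower path can be raised at the end of the flat stretch that contains \<open>j\<close>: up to there the upper
  path has stayed strictly above it, and since the two paths end at the same height the stretch
  ends before \<open>N\<close>.\<close>

lemma lattice_paths_raise_below:
  assumes g: "g \<in> lattice_paths k N" and g': "g' \<in> lattice_paths k N"
    and le: "g \<le> g'" and ne: "g \<noteq> g'"
  shows "\<exists>i. raise i g \<in> lattice_paths k N \<and> raise i g \<le> g'"
proof -
  have mono: "mono g" "mono g'"
    using g g' by (auto simp: lattice_paths_def mono_iff_le_Suc)
  have step: "g j \<le> g (Suc j)" "g (Suc j) \<le> Suc (g j)" "g' (Suc j) \<le> Suc (g' j)" for j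
    using g g' by (auto simp: lattice_paths_def)
  have end_eq: "g 0 = 0" "g' 0 = 0" "j \<ge> N \<Longrightarrow> g j = k" "j \<ge> N \<Longrightarrow> g' j = k" for j
    using g g' by (auto simp: lattice_paths_def)
  define j where "j = (LEAST j. g j < g' j)"
  have "\<exists>j. g j < g' j" using le ne by (metis antisym_conv le_fun_def not_le_imp_less)
  then have j: "g j < g' j" and j_min: "\<And>m. m < j \<Longrightarrow> \<not> g m < g' m"
    unfolding j_def by (auto intro: LeastI_ex dest: not_less_Least)
  have "j \<noteq> 0" using j end_eq by (metis less_irrefl)
  then obtain j0 where j0: "j = Suc j0" using not0_implies_Suc by blast
  have "g j0 = g' j0" using j_min[of j0] le j0 by (simp add: le_fun_def le_antisym not_less)
  then have flat_before: "g j = g j0" using step[of j0] j unfolding j0 by linarith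
  define i where "i = Max {m. j \<le> m \<and> g m = g j}"
  have bounded: "m < N" if "j \<le> m" "g m = g j" for m
  proof (rule ccontr)
    assume "\<not> m < N"
    then have "g m = g' m" using end_eq by simp
    moreover have "g' j \<le> g' m" using mono(2) that(1) by (rule monoD)
    ultimately show False using j that(2) by simp
  qed
  have fin: "finite {m. j \<le> m \<and> g m = g j}"
    by (rule finite_subset[of _ "{..<N}"]) (auto dest: bounded)
  have "i \<in> {m. j \<le> m \<and> g m = g j}" unfolding i_def by (rule Max_in[OF fin]) auto
  then have i: "j \<le> i" "g i = g j" by auto
  have "Suc i \<notin> {m. j \<le> m \<and> g m = g j}" unfolding i_def using Max_ge[OF fin] by (metis Suc_n_not_le_n i_def)
  then have after: "g (Suc i) = Suc (g i)" using i step[of i] by auto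
  obtain i0 where i0: "i = Suc i0" using i(1) j0 by (metis Suc_le_D)
  have before: "g i0 = g i"
  proof (cases "i = j")
    case False
    then have "g j \<le> g i0" "g i0 \<le> g i" using i i0 monoD[OF mono(1), of j i0] monoD[OF mono(1), of i0 i]
      by auto
    then show ?thesis using i by simp
  qed (use i0 j0 flat_before in auto)
  have less: "g i < g' i" using j i monoD[OF mono(2) i(1)] by simp
  have "i < N" using bounded i by blast
  then have "raise i g \<in> lattice_paths k N"
    using g i0 before after unfolding lattice_paths_def raise_def by auto
  moreover have "raise i g \<le> g'" using le less by (simp add: raise_def le_fun_def)
  ultimately show ?thesis by blast
qed

lemma raise_sandwich:
  assumes "g \<le> z" "z \<le> raise i g"
  shows "z = g \<or> z = raise i g"
proof (cases "z i = g i")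
  case True
  then have "z m = g m" for m
    using assms[unfolded le_fun_def, THEN spec, of m] by (cases "m = i") (auto simp: raise_def)
  then show ?thesis by blast
next
  case False
  then have "z m = raise i g m" for m
    using assms[unfolded le_fun_def, THEN spec, of m] by (cases "m = i") (auto simp: raise_def)
  then show ?thesis by blast
qed

text \<open>  The order of the lattice is transported along a bijection to the lattice paths; its covering
  relation is then generated by raises because a path strictly below another can always be raised
  once without leaving the interval between them.\<close>

lemma covers_iff_raise:
  assumes bij: "bij_betw h V (lattice_paths k N)" and "x \<in> V" "y \<in> V"
  shows "covers \<lparr>carrier = V, eq = (=), le = \<lambda>x y. h x \<le> h y\<rparr> y x \<longleftrightarrow> (\<exists>i. h y = raise i (h x))"
    (is "covers ?L y x \<longleftrightarrow> _")
proof -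
  have inj: "h a = h b \<longleftrightarrow> a = b" if "a \<in> V" "b \<in> V" for a b
    using bij that by (auto simp: bij_betw_def dest: inj_onD)
  have lless: "a \<sqsubset>\<^bsub>?L\<^esub> b \<longleftrightarrow> h a \<le> h b \<and> a \<noteq> b" for a b by (simp add: lless_def)
  show ?thesis
  proof
    assume c: "covers ?L y x"
    then have "h x \<le> h y" "h x \<noteq> h y" using inj assms by (auto simp: covers_def lless)
    then obtain i where i: "raise i (h x) \<in> lattice_paths k N" "raise i (h x) \<le> h y"
      using lattice_paths_raise_below[of "h x" k N "h y"] bij assms by (auto simp: bij_betw_def)
    then obtain z where z: "z \<in> V" "h z = raise i (h x)" using bij by (force simp: bij_betw_def)
    have "h x \<le> h z" "h x \<noteq> h z"
      using z by (auto simp: raise_def le_fun_def fun_eq_iff)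
    then have "z = y" using c z i by (auto simp: covers_def lless)
    then show "\<exists>i. h y = raise i (h x)" using z by blast
  next
    assume "\<exists>i. h y = raise i (h x)"
    then obtain i where i: "h y = raise i (h x)" by blast
    then have "h x \<le> h y" "h x \<noteq> h y" by (auto simp: raise_def le_fun_def fun_eq_iff)
    moreover have "z = x \<or> z = y" if "z \<in> V" "h x \<le> h z" "h z \<le> h y" for z
      using raise_sandwich[of "h x" "h z" i] that i inj[of z x] inj[of z y] assms by auto
    ultimately show "covers ?L y x" using assms by (auto simp: covers_def lless)
  qed
qed

lemma raise_index_unique: "raise i g = raise j g \<Longrightarrow> i = j"
  by (auto simp: raise_def fun_eq_iff split: if_splits)

text \<open>  Two ways to raise a path at two points that pass through different intermediate paths use the
  same two points in opposite order.\<close>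

lemma raise_diamond:
  assumes "raise a (raise i g) = raise b (raise j g)" "raise i g \<noteq> raise j g"
  shows "a = j" "b = i"
proof -
  have "i \<noteq> j" using assms(2) by blast
  then show "a = j" "b = i"
    using fun_cong[OF assms(1), of i] fun_cong[OF assms(1), of j]
    by (auto simp: raise_def split: if_splits)
qed

section \<open>Counting functions of sets of numbers\<close>

definition count_upto :: "nat set \<Rightarrow> nat \<Rightarrow> nat" where
  "count_upto A m = card {a \<in> A. a \<le> m}"

definition replaces :: "nat \<Rightarrow> nat \<Rightarrow> nat set \<Rightarrow> nat set \<Rightarrow> bool" where
  "replaces y x A B \<longleftrightarrow> y \<in> A \<and> x \<notin> A \<and> B = insert x (A - {y})"

lemma replaces_converse: "replaces y x A B \<longleftrightarrow> replaces x y B A"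
  by (auto simp: replaces_def)

lemma count_upto_0: "count_upto A 0 = of_bool (0 \<in> A)"
proof -
  have "{a \<in> A. a \<le> 0} = (if 0 \<in> A then {0} else {})" by auto
  then show ?thesis by (simp add: count_upto_def)
qed

lemma count_upto_Suc: "count_upto A (Suc m) = count_upto A m + of_bool (Suc m \<in> A)"
proof (cases "Suc m \<in> A")
  case True
  then have "{a \<in> A. a \<le> Suc m} = insert (Suc m) {a \<in> A. a \<le> m}" by auto
  with True show ?thesis by (simp add: count_upto_def)
next
  case False
  then have "a \<le> Suc m \<longleftrightarrow> a \<le> m" if "a \<in> A" for a
    using that by (metis le_Suc_eq)
  with False show ?thesis by (simp add: count_upto_def cong: conj_cong)
qed

lemma count_upto_eq_imp_eq:
  assumes "count_upto A = count_upto B"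
  shows "A = B"
proof (rule Set.set_eqI)
  fix n show "n \<in> A \<longleftrightarrow> n \<in> B"
  proof (cases n)
    case 0
    then show ?thesis using fun_cong[OF assms, of 0] by (simp add: count_upto_0 split: split_of_bool_asm)
  next
    case (Suc m)
    then show ?thesis using fun_cong[OF assms, of m] fun_cong[OF assms, of "Suc m"]
      by (simp add: count_upto_Suc split: split_of_bool_asm)
  qed
qed

lemma count_upto_insert_remove:
  assumes "y \<in> A" "x \<notin> A"
  shows "count_upto (insert x (A - {y})) m + of_bool (y \<le> m) = count_upto A m + of_bool (x \<le> m)"
  using assms
  by (induction m) (auto simp: count_upto_0 count_upto_Suc le_Suc_eq intro: gr0I)

text \<open>  Moving an element down from \<open>y\<close> to \<open>x\<close> adds 1 to the counting function exactly on the interval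
  from \<open>x\<close> to \<open>y - 1\<close>, and the counting function determines the set. This one equivalence serves
  twice: with \<open>y = x + 2\<close> it describes dominoes by the two diagonals that they meet, and with
  \<open>y = x + 1\<close> it describes the steps of the relabelled subsets as raises of lattice paths.\<close>

lemma replaces_iff_count_upto:
  assumes "x < y"
  shows "replaces y x A B \<longleftrightarrow> (\<forall>m. count_upto B m = count_upto A m + of_bool (x \<le> m \<and> m < y))"
    (is "?l \<longleftrightarrow> ?r")
proof
  assume ?l
  then have y: "y \<in> A" "x \<notin> A" "B = insert x (A - {y})" by (auto simp: replaces_def)
  show ?r
  proof
    fix m
    show "count_upto B m = count_upto A m + of_bool (x \<le> m \<and> m < y)"
      using count_upto_insert_remove[OF y(1,2), of m] assms by (auto simp: y(3))
  qed
next
  assume r: ?r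
  have "x \<in> B \<and> x \<notin> A"
  proof (cases x)
    case 0
    then show ?thesis using r[rule_format, of 0] assms by (simp add: count_upto_0 split: split_of_bool_asm)
  next
    case (Suc m)
    then show ?thesis using r[rule_format, of m] r[rule_format, of x] assms
      by (simp add: count_upto_Suc split: split_of_bool_asm)
  qed
  moreover have "y \<in> A"
    using r[rule_format, of "y - 1"] r[rule_format, of y] assms
    by (cases y) (auto simp: count_upto_Suc split: split_of_bool_asm)
  ultimately have A: "y \<in> A" "x \<notin> A" by auto
  have "count_upto (insert x (A - {y})) m = count_upto B m" for m
    using count_upto_insert_remove[OF A, of m] r[rule_format, of m] assms by auto
  then have "insert x (A - {y}) = B" by (intro count_upto_eq_imp_eq ext)
  with A show ?l by (auto simp: replaces_def)
qed

section \<open>Partitions as subsets\<close>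

lemma board_partitions_part_le:
  assumes "\<sigma> \<in> board_partitions k N" "1 \<le> i" "i \<le> k"
  shows "part \<sigma> i \<le> N - k"
  using assms by (auto simp: board_partitions_def part_def)

lemma board_partitions_part_antimono:
  assumes "\<sigma> \<in> board_partitions k N" "1 \<le> i" "i \<le> j" "j \<le> k"
  shows "part \<sigma> j \<le> part \<sigma> i"
proof (cases "i = j")
  case False
  then show ?thesis
    using assms sorted_wrt_nth_less[of "(\<ge>)" \<sigma> "i - 1" "j - 1"]
    by (auto simp: board_partitions_def part_def)
qed simp

lemma board_partitions_eqI:
  assumes "\<sigma> \<in> board_partitions k N" "\<tau> \<in> board_partitions k N"
    and "\<And>j. 1 \<le> j \<Longrightarrow> j \<le> k \<Longrightarrow> part \<sigma> j = part \<tau> j"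
  shows "\<sigma> = \<tau>"
proof (rule nth_equalityI)
  show "length \<sigma> = length \<tau>" using assms by (simp add: board_partitions_def)
next
  fix i assume "i < length \<sigma>"
  then show "\<sigma> ! i = \<tau> ! i"
    using assms(3)[of "Suc i"] assms(1) by (simp add: board_partitions_def part_def)
qed

lemma S_set_image: "S_set k \<sigma> = (\<lambda>j. part \<sigma> j + k - j + 1) ` {1..k}"
  by (auto simp: S_set_def)

lemma S_set_element_strict_antimono:
  assumes "\<sigma> \<in> board_partitions k N" "1 \<le> i" "i < j" "j \<le> k"
  shows "part \<sigma> j + k - j + 1 < part \<sigma> i + k - i + 1"
  using board_partitions_part_antimono[of \<sigma> k N i j] assms by linarith

lemma inj_on_S_set_element:
  assumes "\<sigma> \<in> board_partitions k N"
  shows "inj_on (\<lambda>j. part \<sigma> j + k - j + 1) {1..k}"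
proof (rule linorder_inj_onI')
  fix i j assume "i \<in> {1..k}" "j \<in> {1..k}" "i < j"
  then show "part \<sigma> i + k - i + 1 \<noteq> part \<sigma> j + k - j + 1"
    using S_set_element_strict_antimono[OF assms, of i j] by simp
qed

lemma finite_S_set: "finite (S_set k \<sigma>)"
  unfolding S_set_image by simp

lemma card_S_set: "\<sigma> \<in> board_partitions k N \<Longrightarrow> card (S_set k \<sigma>) = k"
  unfolding S_set_image by (subst card_image[OF inj_on_S_set_element]) auto

lemma S_set_subset:
  assumes "\<sigma> \<in> board_partitions k N" "k \<le> N"
  shows "S_set k \<sigma> \<subseteq> {1..N}"
proof
  fix s assume "s \<in> S_set k \<sigma>"
  then obtain j where "j \<in> {1..k}" "s = part \<sigma> j + k - j + 1" by (auto simp: S_set_image)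
  then show "s \<in> {1..N}" using board_partitions_part_le[OF assms(1), of j] assms(2) by auto
qed

lemma count_upto_le_card: "finite A \<Longrightarrow> count_upto A m \<le> card A"
  unfolding count_upto_def by (rule card_mono) auto

lemma count_upto_le: 
  assumes "0 \<notin> A" 
  shows "count_upto A m \<le> m"
proof -
  have "{a \<in> A. a \<le> m} \<subseteq> {1..m}" using assms by (auto simp: Suc_le_eq intro: gr0I)
  then show ?thesis using card_mono[of "{1..m}"] by (fastforce simp: count_upto_def)
qed

lemma zero_notin_S_set: "0 \<notin> S_set k \<sigma>"
  by (auto simp: S_set_def)

text \<open>  The elements of \<open>S_set k \<sigma>\<close> decrease from row to row, so the element of row \<open>r\<close> exceeds \<open>c + k - r\<close>
  iff at most \<open>k - r\<close> elements do not.\<close>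

lemma part_ge_iff_count_upto:
  assumes \<sigma>: "\<sigma> \<in> board_partitions k N" and r: "1 \<le> r" "r \<le> k"
  shows "c \<le> part \<sigma> r \<longleftrightarrow> count_upto (S_set k \<sigma>) (c + k - r) + r \<le> k"
proof -
  let ?s = "\<lambda>j. part \<sigma> j + k - j + 1"
  let ?J = "{j \<in> {1..k}. ?s j \<le> c + k - r}"
  have "{a \<in> S_set k \<sigma>. a \<le> c + k - r} = ?s ` ?J" by (auto simp: S_set_image)
  then have count: "count_upto (S_set k \<sigma>) (c + k - r) = card ?J"
    unfolding count_upto_def
    using inj_on_subset[OF inj_on_S_set_element[OF \<sigma>]] by (simp add: card_image subset_eq)
  show ?thesis
  proof
    assume c: "c \<le> part \<sigma> r"
    have "?J \<subseteq> {r<..k}"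
    proof
      fix j assume "j \<in> ?J"
      then show "j \<in> {r<..k}"
        using board_partitions_part_antimono[OF \<sigma>, of j r] c r by (cases "j \<le> r") auto
    qed
    then have "card ?J \<le> card {r<..k}" by (intro card_mono) auto
    then show "count_upto (S_set k \<sigma>) (c + k - r) + r \<le> k" using count r by simp
  next
    assume count_le: "count_upto (S_set k \<sigma>) (c + k - r) + r \<le> k"
    show "c \<le> part \<sigma> r"
    proof (rule ccontr)
      assume c: "\<not> c \<le> part \<sigma> r"
      have "{r..k} \<subseteq> ?J"
      proof
        fix j assume "j \<in> {r..k}"
        then show "j \<in> ?J"
          using board_partitions_part_antimono[OF \<sigma>, of r j] c r by auto
      qed
      then have "card {r..k} \<le> card ?J" by (intro card_mono) auto
      then show False using count count_le r by simp
    qed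
  qed
qed

text \<open>  The number \<open>c + k - r\<close> depends only on the diagonal of the box: along a diagonal, the shape
  consists of the boxes down to a row that the counting function prescribes.\<close>

lemma mem_shape_iff:
  assumes "\<sigma> \<in> board_partitions k N"
  shows "(r, c) \<in> shape \<sigma> \<longleftrightarrow>
    1 \<le> r \<and> 1 \<le> c \<and> count_upto (S_set k \<sigma>) (c + k - r) + r \<le> k"
  using part_ge_iff_count_upto[OF assms, of r c] assms
  by (auto simp: shape_def board_partitions_def)

lemma S_set_inj: "inj_on (S_set k) (board_partitions k N)"
proof (rule inj_onI)
  fix \<sigma> \<tau> assume \<sigma>\<tau>: "\<sigma> \<in> board_partitions k N" "\<tau> \<in> board_partitions k N"
    and eq: "S_set k \<sigma> = S_set k \<tau>"
  show "\<sigma> = \<tau>"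
  proof (rule board_partitions_eqI[OF \<sigma>\<tau>])
    fix j assume "1 \<le> j" "j \<le> k"
    then have "c \<le> part \<sigma> j \<longleftrightarrow> c \<le> part \<tau> j" for c
      using part_ge_iff_count_upto \<sigma>\<tau> eq by metis
    then show "part \<sigma> j = part \<tau> j" by (metis le_antisym order_refl)
  qed
qed

text \<open>  The \<open>i\<close>-th smallest element of a \<open>k\<close>-subset is at least \<open>i\<close>, and its excess over \<open>i\<close> is a part of
  the partition.\<close>

lemma S_set_surj:
  assumes A: "A \<subseteq> {1..N}" "card A = k"
  shows "\<exists>\<sigma>\<in>board_partitions k N. S_set k \<sigma> = A"
proof -
  define l where "l = sorted_list_of_set A"
  have fin: "finite A" using A finite_subset by blast
  have l: "sorted_wrt (<) l" "length l = k" "set l = A"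
    using fin A by (simp_all add: l_def)
  have gap: "l ! i + (j - i) \<le> l ! j" if "i \<le> j" "j < k" for i j
    using that
  proof (induction j rule: dec_induct)
    case (step n)
    moreover have "l ! n < l ! Suc n" using sorted_wrt_nth_less[OF l(1)] step l by simp
    ultimately show ?case by simp
  qed simp
  have range: "1 \<le> l ! i \<and> l ! i \<le> N" if "i < k" for i
    using nth_mem[of i l] l A that by auto
  have low: "i + 1 \<le> l ! i" if "i < k" for i
    using gap[of 0 i] range[of 0] that by simp
  have high: "l ! i + (k - 1 - i) \<le> N" if "i < k" for i
    using gap[of i "k - 1"] range[of "k - 1"] that by force
  define \<sigma> where "\<sigma> = map (\<lambda>i. l ! (k - 1 - i) - (k - i)) [0..<k]"
  have part: "part \<sigma> j + k - j + 1 = l ! (k - j)" if "1 \<le> j" "j \<le> k" for j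
    using that low[of "k - j"] nth_upt[of 0 "j - 1" k]
    by (simp add: part_def \<sigma>_def)
  have "\<sigma> \<in> board_partitions k N"
    unfolding board_partitions_def
  proof (intro CollectI conjI)
    show "length \<sigma> = k" by (simp add: \<sigma>_def)
    show "sorted_wrt (\<ge>) \<sigma>"
      unfolding sorted_wrt_iff_nth_less
    proof (intro allI impI)
      fix i j assume ij: "i < j" "j < length \<sigma>"
      then have "j < k" by (simp add: \<sigma>_def)
      then show "\<sigma> ! j \<le> \<sigma> ! i"
        using gap[of "k - 1 - j" "k - 1 - i"] low[of "k - 1 - j"] ij
        by (simp add: \<sigma>_def) linarith
    qed
    show "\<forall>p\<in>set \<sigma>. p \<le> N - k"
    proof
      fix p assume "p \<in> set \<sigma>"
      then obtain i where i: "i < k" "p = l ! (k - 1 - i) - (k - i)" by (auto simp: \<sigma>_def)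
      then show "p \<le> N - k" using high[of "k - 1 - i"] low[of "k - 1 - i"] by simp
    qed
  qed
  moreover have "S_set k \<sigma> = A"
  proof -
    have "S_set k \<sigma> = (\<lambda>j. l ! (k - j)) ` {1..k}"
      unfolding S_set_image using part by (intro image_cong) auto
    also have "\<dots> = (!) l ` ((\<lambda>j. k - j) ` {1..k})" by (simp add: image_image)
    also have "(\<lambda>j. k - j) ` {1..k} = {..<k}"
    proof
      show "{..<k} \<subseteq> (\<lambda>j. k - j) ` {1..k}"
      proof
        fix i assume "i \<in> {..<k}"
        then show "i \<in> (\<lambda>j. k - j) ` {1..k}" by (intro image_eqI[of _ _ "k - i"]) auto
      qed
    qed auto
    also have "(!) l ` {..<k} = A" using l by (auto simp: set_conv_nth)
    finally show ?thesis .
  qed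
  ultimately show ?thesis by blast
qed

lemma bij_betw_S_set:
  assumes "k \<le> N"
  shows "bij_betw (S_set k) (board_partitions k N) {A. A \<subseteq> {1..N} \<and> card A = k}"
  unfolding bij_betw_def
proof (intro conjI S_set_inj)
  show "S_set k ` board_partitions k N = {A. A \<subseteq> {1..N} \<and> card A = k}"
  proof (intro equalityI subsetI)
    fix A assume "A \<in> S_set k ` board_partitions k N"
    then obtain \<sigma> where "\<sigma> \<in> board_partitions k N" "A = S_set k \<sigma>" by (rule imageE)
    then show "A \<in> {A. A \<subseteq> {1..N} \<and> card A = k}"
      using S_set_subset[OF _ assms] card_S_set by simp
  next
    fix A assume "A \<in> {A. A \<subseteq> {1..N} \<and> card A = k}"
    then obtain \<sigma> where "\<sigma> \<in> board_partitions k N" "S_set k \<sigma> = A" using S_set_surj[of A N k] by blast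
    then show "A \<in> S_set k ` board_partitions k N" by (metis imageI)
  qed
qed

section \<open>Moves as replacements of one element\<close>

text \<open>  The diagonals are indexed by \<open>m = c + k - r\<close>, stated without subtraction; the upper right
  corner of the board lies on the diagonal \<open>N - 1\<close>.\<close>

definition diagonal :: "nat \<Rightarrow> nat \<Rightarrow> (nat \<times> nat) set" where
  "diagonal k m = {(r, c). c + k = m + r}"

text \<open>  Within the first \<open>k\<close> rows the diagonal \<open>m\<close> has its boxes in the rows from \<open>k - m + 1\<close> on, and the
  shape contains those down to the row \<open>k - count_upto (S_set k \<sigma>) m\<close>.\<close>

lemma card_shape_diagonal:
  assumes \<sigma>: "\<sigma> \<in> board_partitions k N"
  shows "card (shape \<sigma> \<inter> diagonal k m) + count_upto (S_set k \<sigma>) m = min k m"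
proof -
  let ?n = "count_upto (S_set k \<sigma>) m"
  have "?n \<le> k" using count_upto_le_card[OF finite_S_set] card_S_set[OF \<sigma>] by metis
  moreover have "?n \<le> m" by (rule count_upto_le[OF zero_notin_S_set])
  moreover have "shape \<sigma> \<inter> diagonal k m = (\<lambda>r. (r, m + r - k)) ` {k - m<..k - ?n}"
    (is "?l = ?r")
  proof (rule Set.set_eqI)
    fix b :: "nat \<times> nat"
    obtain r c where b: "b = (r, c)" by fastforce
    have *: "c + k - r = m" if "c + k = m + r" using that by simp
    have "b \<in> ?l \<longleftrightarrow> 1 \<le> r \<and> 1 \<le> c \<and> ?n + r \<le> k \<and> c + k = m + r"
      using mem_shape_iff[OF \<sigma>, of r c] * by (auto simp: b diagonal_def)
    also have "\<dots> \<longleftrightarrow> b \<in> ?r"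
      using \<open>?n \<le> k\<close> by (auto simp: b image_iff)
    finally show "b \<in> ?l \<longleftrightarrow> b \<in> ?r" .
  qed
  moreover have "inj (\<lambda>r. (r, m + r - k))" by (auto intro: injI)
  ultimately show ?thesis
    by (simp add: card_image inj_on_subset min_def)
qed

text \<open>  A larger shape means a smaller counting function: the boxes on the diagonal \<open>m\<close> and the elements
  up to \<open>m\<close> together number \<open>min k m\<close>.\<close>

lemma adds_imp_count_upto:
  assumes \<sigma>: "\<sigma> \<in> board_partitions k N" and \<tau>: "\<tau> \<in> board_partitions k N"
    and adds: "adds \<sigma> \<tau> X"
  shows "count_upto (S_set k \<sigma>) m = count_upto (S_set k \<tau>) m + card (X \<inter> diagonal k m)"
proof -
  have fin: "finite (shape \<tau>)"
  proof (rule finite_subset)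
    show "shape \<tau> \<subseteq> {1..k} \<times> {1..N - k}"
    proof
      fix b assume "b \<in> shape \<tau>"
      then obtain r c where "b = (r, c)" "1 \<le> r" "r \<le> k" "1 \<le> c" "c \<le> part \<tau> r"
        using \<tau> by (auto simp: shape_def board_partitions_def)
      then show "b \<in> {1..k} \<times> {1..N - k}" using board_partitions_part_le[OF \<tau>, of r] by simp
    qed
  qed simp
  have "shape \<tau> \<inter> diagonal k m = (shape \<sigma> \<inter> diagonal k m) \<union> (X \<inter> diagonal k m)"
    "(shape \<sigma> \<inter> diagonal k m) \<inter> (X \<inter> diagonal k m) = {}"
    "shape \<sigma> \<subseteq> shape \<tau>" "X \<subseteq> shape \<tau>"
    using adds by (auto simp: adds_def)
  then have "card (shape \<tau> \<inter> diagonal k m) =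
      card (shape \<sigma> \<inter> diagonal k m) + card (X \<inter> diagonal k m)"
    using fin by (metis card_Un_disjoint finite_Int finite_subset)
  then show ?thesis
    using card_shape_diagonal[OF \<sigma>, of m] card_shape_diagonal[OF \<tau>, of m] by linarith
qed

text \<open>  Conversely, when the counts drop by 1 on a set of diagonals, the shape gains one box on each of
  them, the next one after its former boxes there.\<close>

lemma count_upto_imp_adds:
  assumes \<sigma>: "\<sigma> \<in> board_partitions k N" and \<tau>: "\<tau> \<in> board_partitions k N"
    and count: "\<And>m. count_upto (S_set k \<sigma>) m = count_upto (S_set k \<tau>) m + of_bool (m \<in> M)"
  shows "adds \<sigma> \<tau> {(r, c). c + k - r \<in> M \<and> count_upto (S_set k \<tau>) (c + k - r) + r = k}"
    (is "adds \<sigma> \<tau> ?X")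
proof -
  have box: "1 \<le> r \<and> 1 \<le> c"
    if "(r, c) \<in> ?X" for r c
  proof -
    have "count_upto (S_set k \<sigma>) (c + k - r) = Suc (count_upto (S_set k \<tau>) (c + k - r))"
      using count that by auto
    moreover have "count_upto (S_set k \<sigma>) (c + k - r) \<le> k"
      using count_upto_le_card[OF finite_S_set] card_S_set[OF \<sigma>] by metis
    moreover have "count_upto (S_set k \<sigma>) (c + k - r) \<le> c + k - r"
      by (rule count_upto_le[OF zero_notin_S_set])
    ultimately show ?thesis using that by auto
  qed
  have union: "(r, c) \<in> shape \<tau> \<longleftrightarrow> (r, c) \<in> shape \<sigma> \<or> (r, c) \<in> ?X" for r c
    using box[of r c] unfolding mem_shape_iff[OF \<sigma>] mem_shape_iff[OF \<tau>] count[of "c + k - r"]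
    by (cases "c + k - r \<in> M") auto
  have disjoint: "(r, c) \<notin> shape \<sigma>" if "(r, c) \<in> ?X" for r c
    using that unfolding mem_shape_iff[OF \<sigma>] count[of "c + k - r"] by auto
  define X where "X = ?X"
  have "X \<inter> shape \<sigma> = {}" using disjoint by (auto simp: X_def)
  moreover have "shape \<tau> = shape \<sigma> \<union> X"
  proof (rule Set.set_eqI)
    fix b
    show "b \<in> shape \<tau> \<longleftrightarrow> b \<in> shape \<sigma> \<union> X"
      by (cases b) (simp only: union X_def Un_iff)
  qed
  ultimately show ?thesis unfolding adds_def X_def by blast
qed

lemma removes_iff_adds: "removes \<sigma> \<tau> X \<longleftrightarrow> adds \<tau> \<sigma> X"
  by (auto simp: removes_def adds_def)

lemma adds_box_bounds:
  assumes "\<tau> \<in> board_partitions k N" "adds \<sigma> \<tau> X" "(r, c) \<in> X"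
  shows "1 \<le> r" "r \<le> k" "1 \<le> c"
proof -
  have "(r, c) \<in> shape \<tau>" using assms by (auto simp: adds_def)
  then show "1 \<le> r" "r \<le> k" "1 \<le> c"
    using assms(1) by (auto simp: shape_def board_partitions_def)
qed

lemma adds_imp_replaces:
  assumes "\<sigma> \<in> board_partitions k N" "\<tau> \<in> board_partitions k N" "adds \<sigma> \<tau> X" "a < b"
    and X: "\<And>m. card (X \<inter> diagonal k m) = of_bool (a \<le> m \<and> m < b)"
  shows "replaces a b (S_set k \<sigma>) (S_set k \<tau>)"
  unfolding replaces_converse[of a] replaces_iff_count_upto[OF \<open>a < b\<close>] X[symmetric]
  using adds_imp_count_upto[OF assms(1-3)] by blast

lemma horizontal_imp_replaces:
  assumes "\<sigma> \<in> board_partitions k N" "\<tau> \<in> board_partitions k N"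
    and adds: "adds \<sigma> \<tau> {(r, c), (r, c + 1)}"
  shows "r \<le> k" "replaces (c + k - r) (c + k - r + 2) (S_set k \<sigma>) (S_set k \<tau>)"
proof -
  show r: "r \<le> k" using adds_box_bounds[OF assms(2) adds, of r c] by simp
  have "{(r, c), (r, c + 1)} \<inter> diagonal k m =
      (if m = c + k - r then {(r, c)} else if m = c + k - r + 1 then {(r, c + 1)} else {})" for m
    using r by (auto simp: diagonal_def)
  then show "replaces (c + k - r) (c + k - r + 2) (S_set k \<sigma>) (S_set k \<tau>)"
    by (intro adds_imp_replaces[OF assms]) auto
qed

lemma vertical_imp_replaces:
  assumes "\<sigma> \<in> board_partitions k N" "\<tau> \<in> board_partitions k N"
    and adds: "adds \<sigma> \<tau> {(r, c), (r + 1, c)}"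
  shows "r + 1 \<le> k" "replaces (c + k - (r + 1)) (c + k - (r + 1) + 2) (S_set k \<sigma>) (S_set k \<tau>)"
proof -
  show r: "r + 1 \<le> k" using adds_box_bounds[OF assms(2) adds, of "r + 1" c] by simp
  have "{(r, c), (r + 1, c)} \<inter> diagonal k m =
      (if m = c + k - (r + 1) then {(r + 1, c)}
       else if m = c + k - (r + 1) + 1 then {(r, c)} else {})" for m
    using r by (auto simp: diagonal_def)
  then show "replaces (c + k - (r + 1)) (c + k - (r + 1) + 2) (S_set k \<sigma>) (S_set k \<tau>)"
    by (intro adds_imp_replaces[OF assms]) auto
qed

text \<open>  The bounds on the counts say that the added boxes have positive row and column, so that the
  subtractions in their coordinates do not truncate.\<close>

lemma replaces_imp_adds:
  assumes \<sigma>: "\<sigma> \<in> board_partitions k N" and \<tau>: "\<tau> \<in> board_partitions k N"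
    and rep: "replaces a b (S_set k \<sigma>) (S_set k \<tau>)" and "a < b"
  shows "adds \<sigma> \<tau> ((\<lambda>m. (k - count_upto (S_set k \<tau>) m, m - count_upto (S_set k \<tau>) m)) ` {a..<b})"
    (is "adds \<sigma> \<tau> (?box ` _)")
    and "m \<in> {a..<b} \<Longrightarrow> count_upto (S_set k \<tau>) m < k"
    and "m \<in> {a..<b} \<Longrightarrow> count_upto (S_set k \<tau>) m < m"
proof -
  let ?c = "count_upto (S_set k \<tau>)"
  have count: "count_upto (S_set k \<sigma>) m = ?c m + of_bool (m \<in> {a..<b})" for m
    using rep unfolding replaces_converse[of a] replaces_iff_count_upto[OF \<open>a < b\<close>] by simp
  have less: "?c m < k \<and> ?c m < m" if "m \<in> {a..<b}" for m
  proof -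
    have "?c m + 1 \<le> k" "?c m + 1 \<le> m"
      using count[of m] that count_upto_le_card[OF finite_S_set, of k \<sigma> m] card_S_set[OF \<sigma>]
        count_upto_le[OF zero_notin_S_set, of k \<sigma> m] by auto
    then show ?thesis by simp
  qed
  then show "m \<in> {a..<b} \<Longrightarrow> ?c m < k" "m \<in> {a..<b} \<Longrightarrow> ?c m < m" by blast+
  have "{(r, c). c + k - r \<in> {a..<b} \<and> ?c (c + k - r) + r = k} = ?box ` {a..<b}"
    (is "?l = ?r")
  proof (intro equalityI subsetI)
    fix x assume "x \<in> ?l"
    then obtain r c where x: "x = (r, c)" "c + k - r \<in> {a..<b}" "?c (c + k - r) + r = k" by blast
    then have "k - ?c (c + k - r) = r" "c + k - r - ?c (c + k - r) = c" by linarith+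
    then have "?box (c + k - r) = x" by (simp only: x(1))
    then show "x \<in> ?r" using x(2) by blast
  next
    fix x assume "x \<in> ?r"
    then obtain m where m: "m \<in> {a..<b}" "x = ?box m" by blast
    then have "m - ?c m + k - (k - ?c m) = m" using less[of m] by simp
    then show "x \<in> ?l" using m less[of m] by auto
  qed
  then show "adds \<sigma> \<tau> (?box ` {a..<b})"
    using count_upto_imp_adds[OF \<sigma> \<tau> count] by simp
qed

text \<open>  The boxes added on the diagonals \<open>a\<close> and \<open>a + 1\<close> are in the same row if the count does not change
  between the diagonals, and in the same column if it increases, that is, if the element jumps over
  \<open>a + 1\<close>.\<close>

lemma replaces_imp_domino:
  assumes "\<sigma> \<in> board_partitions k N" "\<tau> \<in> board_partitions k N"
    and "replaces a (a + 2) (S_set k \<sigma>) (S_set k \<tau>)"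
  obtains (horizontal) r c where "r \<le> k" "c + k - r = a" "adds \<sigma> \<tau> {(r, c), (r, c + 1)}"
    | (vertical) r c where "r + 1 \<le> k" "c + k - (r + 1) = a" "adds \<sigma> \<tau> {(r, c), (r + 1, c)}"
proof -
  let ?c = "count_upto (S_set k \<tau>)"
  have "{a..<a + 2} = {a, a + 1}" by auto
  then have adds: "adds \<sigma> \<tau> {(k - ?c a, a - ?c a), (k - ?c (a + 1), a + 1 - ?c (a + 1))}"
    and less: "?c a < k" "?c a < a" "?c (a + 1) < k"
    using replaces_imp_adds[OF assms] by auto
  show thesis
  proof (cases "a + 1 \<in> S_set k \<tau>")
    case False
    then have "?c (a + 1) = ?c a" by (simp add: count_upto_Suc)
    then show thesis using adds less by (intro horizontal[of "k - ?c a" "a - ?c a"]) (auto simp: Suc_diff_le)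
  next
    case True
    then have "?c (a + 1) = ?c a + 1" by (simp add: count_upto_Suc)
    then show thesis using adds less
      by (intro vertical[of "k - ?c (a + 1)" "a - ?c a"]) (auto simp: insert_commute Suc_diff_Suc)
  qed
qed

text \<open>  The color of a square depends only on the parity of its diagonal.\<close>

lemma red_iff_odd:
  assumes "r \<le> k" "k \<le> N"
  shows "red k N (r, c) \<longleftrightarrow> odd (c + k - r + N)"
proof -
  obtain d e where "k = r + d" "N = k + e" using assms by (metis le_Suc_ex)
  then show ?thesis by (simp add: red_def) presburger
qed

text \<open>  The parameter \<open>b\<close> tells whether the box on the lower of the two diagonals is red: it is white in
  the dominoes that may be added, and red in those that may be removed.\<close>

lemma domino_iff_replaces:
  assumes \<sigma>: "\<sigma> \<in> board_partitions k N" and \<tau>: "\<tau> \<in> board_partitions k N" and "k \<le> N"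
  shows "(\<exists>r c. red k N (r, c) = b \<and> red k N (r, c + 1) = (\<not> b) \<and> adds \<sigma> \<tau> {(r, c), (r, c + 1)}) \<or>
     (\<exists>r c. red k N (r, c) = (\<not> b) \<and> red k N (r + 1, c) = b \<and> adds \<sigma> \<tau> {(r, c), (r + 1, c)}) \<longleftrightarrow>
     (\<exists>a. odd (a + N) = b \<and> replaces a (a + 2) (S_set k \<sigma>) (S_set k \<tau>))"
    (is "?horizontal \<or> ?vertical \<longleftrightarrow> ?replaces")
proof
  assume "?horizontal \<or> ?vertical"
  then show ?replaces
  proof
    assume ?horizontal
    then obtain r c where "red k N (r, c) = b" "adds \<sigma> \<tau> {(r, c), (r, c + 1)}" by blast
    then show ?replaces
      using horizontal_imp_replaces[OF \<sigma> \<tau>, of r c] red_iff_odd[OF _ \<open>k \<le> N\<close>, of r c] by blast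
  next
    assume ?vertical
    then obtain r c where "red k N (r + 1, c) = b" "adds \<sigma> \<tau> {(r, c), (r + 1, c)}" by blast
    then show ?replaces
      using vertical_imp_replaces[OF \<sigma> \<tau>, of r c] red_iff_odd[OF _ \<open>k \<le> N\<close>, of "r + 1" c] by blast
  qed
next
  assume ?replaces
  then obtain a where a: "odd (a + N) = b" and rep: "replaces a (a + 2) (S_set k \<sigma>) (S_set k \<tau>)"
    by blast
  from \<sigma> \<tau> rep show "?horizontal \<or> ?vertical"
  proof (cases rule: replaces_imp_domino)
    case (horizontal r c)
    have "c + 1 + k - r = c + k - r + 1" using horizontal(1) by simp
    then have "red k N (r, c) \<longleftrightarrow> odd (a + N)" "red k N (r, c + 1) \<longleftrightarrow> odd (a + 1 + N)"
      using red_iff_odd[OF horizontal(1) \<open>k \<le> N\<close>] by (simp_all only: horizontal(2))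
    then have "red k N (r, c) = b \<and> red k N (r, c + 1) = (\<not> b)" using a by auto
    then show ?thesis using horizontal(3) by blast
  next
    case (vertical r c)
    have "c + k - r = c + k - (r + 1) + 1" using vertical(1) by simp
    moreover have "r \<le> k" using vertical(1) by simp
    ultimately have "red k N (r, c) \<longleftrightarrow> odd (a + 1 + N)" "red k N (r + 1, c) \<longleftrightarrow> odd (a + N)"
      using red_iff_odd[OF _ \<open>k \<le> N\<close>] vertical(1) by (simp_all only: vertical(2))
    then have "red k N (r, c) = (\<not> b) \<and> red k N (r + 1, c) = b" using a by auto
    then show ?thesis using vertical(3) by blast
  qed
qed

lemma corner_iff_replaces:
  assumes \<sigma>: "\<sigma> \<in> board_partitions k N" and \<tau>: "\<tau> \<in> board_partitions k N"
    and kN: "1 \<le> k" "k < N"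
  shows "adds \<sigma> \<tau> {(1, N - k)} \<longleftrightarrow> replaces (N - 1) N (S_set k \<sigma>) (S_set k \<tau>)"
proof
  assume adds: "adds \<sigma> \<tau> {(1, N - k)}"
  have "{(1, N - k)} \<inter> diagonal k m = (if m = N - 1 then {(1, N - k)} else {})" for m
    using kN by (auto simp: diagonal_def)
  then show "replaces (N - 1) N (S_set k \<sigma>) (S_set k \<tau>)"
    using kN by (intro adds_imp_replaces[OF \<sigma> \<tau> adds]) auto
next
  assume rep: "replaces (N - 1) N (S_set k \<sigma>) (S_set k \<tau>)"
  let ?c = "count_upto (S_set k \<tau>)"
  have "?c N = k"
  proof -
    have "{a \<in> S_set k \<tau>. a \<le> N} = S_set k \<tau>" using S_set_subset[OF \<tau>] kN by auto
    then show ?thesis using card_S_set[OF \<tau>] by (simp add: count_upto_def)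
  qed
  moreover have "N \<in> S_set k \<tau>" using rep by (simp add: replaces_def)
  ultimately have "?c (N - 1) = k - 1"
    using count_upto_Suc[of "S_set k \<tau>" "N - 1"] kN by simp
  moreover have "{N - 1..<N} = {N - 1}" using kN by auto
  ultimately show "adds \<sigma> \<tau> {(1, N - k)}"
    using replaces_imp_adds(1)[OF \<sigma> \<tau> rep] kN by simp
qed

section \<open>The linear order behind the colors\<close>

text \<open>  The linear order along which the elements move, listed from its top element \<open>chain N 1\<close> down, so
  that a step replaces \<open>chain N (i + 1)\<close> by \<open>chain N i\<close>. The numbers whose parity differs from that
  of \<open>N\<close> come first in increasing order, then those of the parity of \<open>N\<close> in decreasing order.\<close>

definition chain :: "nat \<Rightarrow> nat \<Rightarrow> nat" where
  "chain N i =
     (if 2 * i \<le> N then 2 * i - (if even N then 1 else 0)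
      else 2 * N - 2 * i + (if even N then 2 else 1))"

lemma color_pair_eq_chain:
  assumes "1 \<le> i" "i \<le> N - 1"
  shows "color_pair N i = (chain N i, chain N (i + 1))"
proof (cases "even N")
  case True
  then obtain n where "N = 2 * n" by blast
  then show ?thesis using assms by (auto simp: color_pair_def chain_def)
next
  case False
  then obtain n where "N = 2 * n + 1" by (rule oddE)
  then show ?thesis using assms by (auto simp: color_pair_def chain_def)
qed

lemma odd_chain_iff:
  assumes "1 \<le> i" "i \<le> N"
  shows "odd (chain N i + N) \<longleftrightarrow> 2 * i \<le> N"
proof (cases "even N")
  case True
  then obtain n where "N = 2 * n" by blast
  then show ?thesis using assms by (simp add: chain_def)
next
  case False
  then obtain n where "N = 2 * n + 1" by (rule oddE)
  then show ?thesis using assms by (simp add: chain_def)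
qed

lemma bij_betw_chain: "bij_betw (chain N) {1..N} {1..N}"
proof -
  have "inj_on (chain N) {1..N}"
  proof (rule linorder_inj_onI')
    fix i j assume ij: "i \<in> {1..N}" "j \<in> {1..N}" "i < j"
    consider "2 * j \<le> N" | "2 * i \<le> N" "N < 2 * j" | "N < 2 * i" by linarith
    then show "chain N i \<noteq> chain N j"
    proof cases
      case 2
      then show ?thesis using odd_chain_iff[of i N] odd_chain_iff[of j N] ij by fastforce
    qed (use ij in \<open>auto simp: chain_def\<close>)
  qed
  moreover have "chain N ` {1..N} \<subseteq> {1..N}"
  proof
    fix x assume "x \<in> chain N ` {1..N}"
    then obtain i where "1 \<le> i" "i \<le> N" "x = chain N i" by auto
    then show "x \<in> {1..N}" unfolding chain_def by (cases "even N") (auto elim!: evenE oddE)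
  qed
  ultimately show ?thesis
    by (simp add: bij_betw_def endo_inj_surj)
qed

text \<open>  The three kinds of consecutive pairs correspond to the removal of a domino, the removal of the
  corner, and the addition of a domino.\<close>

lemma chain_step_cases:
  assumes "1 \<le> i" "i \<le> N - 1"
  obtains (up) "chain N (i + 1) = chain N i + 2" "odd (chain N i + N)"
    | (top) "chain N i = N - 1" "chain N (i + 1) = N"
    | (down) "chain N i = chain N (i + 1) + 2" "even (chain N (i + 1) + N)"
proof (cases "even N")
  case True
  then obtain n where n: "N = 2 * n" by blast
  consider "i < n" | "i = n" | "n < i" by linarith
  then show thesis
  proof cases
    case 1 then show thesis using assms n by (intro up) (auto simp: chain_def)
  next
    case 2 then show thesis using assms n by (intro top) (auto simp: chain_def)
  next
    case 3 then show thesis using assms n by (intro down) (auto simp: chain_def)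
  qed
next
  case False
  then obtain n where n: "N = 2 * n + 1" by (rule oddE)
  consider "i < n" | "i = n" | "n < i" by linarith
  then show thesis
  proof cases
    case 1 then show thesis using assms n by (intro up) (auto simp: chain_def)
  next
    case 2 then show thesis using assms n by (intro top) (auto simp: chain_def)
  next
    case 3 then show thesis using assms n by (intro down) (auto simp: chain_def)
  qed
qed

lemma chain_up_step:
  assumes "odd (a + N)" "1 \<le> a" "a + 2 \<le> N"
  shows "\<exists>i\<in>{1..N - 1}. chain N i = a \<and> chain N (i + 1) = a + 2"
proof (cases "even N")
  case True
  then obtain n b where nb: "N = 2 * n" "a = 2 * b + 1" using assms by (auto elim!: evenE oddE)
  then have "b + 2 \<le> n" using assms by linarith
  with nb show ?thesis by (intro bexI[of _ "b + 1"]) (simp_all add: chain_def)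
next
  case False
  then obtain n b where "N = 2 * n + 1" "a = 2 * b" using assms by (auto elim!: evenE oddE)
  then show ?thesis using assms by (intro bexI[of _ b]) (auto simp: chain_def)
qed

lemma chain_down_step:
  assumes "even (a + N)" "1 \<le> a" "a + 2 \<le> N"
  shows "\<exists>i\<in>{1..N - 1}. chain N i = a + 2 \<and> chain N (i + 1) = a"
proof (cases "even N")
  case True
  then obtain n b where "N = 2 * n" "a = 2 * b" using assms by (auto elim!: evenE)
  then show ?thesis using assms by (intro bexI[of _ "N - b"]) (auto simp: chain_def)
next
  case False
  then obtain n b where "N = 2 * n + 1" "a = 2 * b + 1" using assms by (auto elim!: evenE oddE)
  then show ?thesis using assms by (intro bexI[of _ "N - b - 1"]) (auto simp: chain_def)
qed

lemma chain_top_step: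
  assumes "2 \<le> N"
  shows "\<exists>i\<in>{1..N - 1}. chain N i = N - 1 \<and> chain N (i + 1) = N"
  using assms by (intro bexI[of _ "N div 2"]) (auto simp: chain_def elim!: evenE oddE)

lemma domino_color_iff_replaces:
  "domino_color k N \<sigma> \<tau> i \<longleftrightarrow>
     i \<in> {1..N - 1} \<and> replaces (chain N (i + 1)) (chain N i) (S_set k \<sigma>) (S_set k \<tau>)"
proof (cases "i \<in> {1..N - 1}")
  case True
  then have "color_pair N i = (chain N i, chain N (i + 1))" by (simp add: color_pair_eq_chain)
  then show ?thesis
    unfolding domino_color_def replaces_converse[of "chain N (i + 1)"]
    by (simp add: replaces_def)
qed (simp only: domino_color_def simp_thms)

text \<open>  The moves are replacements by a neighbour in one half of the chain, or across its turning point
  between \<open>N\<close> and \<open>N - 1\<close>; the consecutive pairs of the chain are exactly these.\<close>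

lemma edge_iff_domino_color:
  assumes \<sigma>: "\<sigma> \<in> board_partitions k N" and \<tau>: "\<tau> \<in> board_partitions k N"
    and kN: "1 \<le> k" "k < N"
  shows "removal_move k N \<sigma> \<tau> \<or> addition_move k N \<sigma> \<tau> \<longleftrightarrow> (\<exists>i. domino_color k N \<sigma> \<tau> i)"
proof -
  let ?R = "\<lambda>y x. replaces y x (S_set k \<sigma>) (S_set k \<tau>)"
  have range: "x \<in> {1..N} \<and> y \<in> {1..N}" if "?R y x" for x y
    using that S_set_subset[OF \<sigma>] S_set_subset[OF \<tau>] kN unfolding replaces_def by auto
  have removal: "removal_move k N \<sigma> \<tau> \<longleftrightarrow> (\<exists>a. odd (a + N) \<and> ?R (a + 2) a) \<or> ?R N (N - 1)"
    using domino_iff_replaces[OF \<tau> \<sigma>, of True] corner_iff_replaces[OF \<tau> \<sigma> kN] kN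
    unfolding removal_move_def removes_iff_adds replaces_converse[of _ _ "S_set k \<sigma>"]
    by simp argo
  have addition: "addition_move k N \<sigma> \<tau> \<longleftrightarrow> (\<exists>a. even (a + N) \<and> ?R a (a + 2))"
    using domino_iff_replaces[OF \<sigma> \<tau>, of False] kN unfolding addition_move_def by simp
  show ?thesis
  proof
    assume "removal_move k N \<sigma> \<tau> \<or> addition_move k N \<sigma> \<tau>"
    then consider a where "odd (a + N)" "?R (a + 2) a" | "?R N (N - 1)"
      | a where "even (a + N)" "?R a (a + 2)"
      unfolding removal addition by blast
    then have "\<exists>i\<in>{1..N - 1}. ?R (chain N (i + 1)) (chain N i)"
    proof cases
      case (1 a)
      then have "1 \<le> a" "a + 2 \<le> N" using range[OF 1(2)] by simp_all
      then obtain i where "i \<in> {1..N - 1}" "chain N i = a" "chain N (i + 1) = a + 2"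
        using chain_up_step[OF 1(1)] by blast
      with 1(2) show ?thesis by (intro bexI[of _ i]) simp_all
    next
      case 2
      obtain i where "i \<in> {1..N - 1}" "chain N i = N - 1" "chain N (i + 1) = N"
        using chain_top_step[of N] kN by fastforce
      with 2 show ?thesis by (intro bexI[of _ i]) simp_all
    next
      case (3 a)
      then have "1 \<le> a" "a + 2 \<le> N" using range[OF 3(2)] by simp_all
      then obtain i where "i \<in> {1..N - 1}" "chain N i = a + 2" "chain N (i + 1) = a"
        using chain_down_step[OF 3(1)] by blast
      with 3(2) show ?thesis by (intro bexI[of _ i]) simp_all
    qed
    then show "\<exists>i. domino_color k N \<sigma> \<tau> i" unfolding domino_color_iff_replaces by blast
  next
    assume "\<exists>i. domino_color k N \<sigma> \<tau> i"
    then obtain i where i: "1 \<le> i" "i \<le> N - 1" and R: "?R (chain N (i + 1)) (chain N i)"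
      unfolding domino_color_iff_replaces by auto
    from i show "removal_move k N \<sigma> \<tau> \<or> addition_move k N \<sigma> \<tau>"
      by (cases rule: chain_step_cases) (use R in \<open>auto simp: removal addition\<close>)
  qed
qed

section \<open>Heights of partitions\<close>

definition height :: "nat \<Rightarrow> nat \<Rightarrow> nat list \<Rightarrow> nat \<Rightarrow> nat" where
  "height k N \<sigma> = count_upto {i \<in> {1..N}. chain N i \<in> S_set k \<sigma>}"

text \<open>  A lattice path is recovered from the set of places where it rises.\<close>

lemma bij_betw_count_upto:
  "bij_betw count_upto {A. A \<subseteq> {1..N} \<and> card A = k} (lattice_paths k N)"
  unfolding bij_betw_def
proof (intro conjI equalityI subsetI)
  show "inj_on count_upto {A. A \<subseteq> {1..N} \<and> card A = k}"
    by (auto intro: inj_onI dest: count_upto_eq_imp_eq)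
next
  fix g assume "g \<in> count_upto ` {A. A \<subseteq> {1..N} \<and> card A = k}"
  then obtain A where A: "A \<subseteq> {1..N}" "card A = k" "g = count_upto A" by blast
  have "count_upto A j = k" if "j \<ge> N" for j
  proof -
    have "{a \<in> A. a \<le> j} = A" using A(1) that by auto
    then show ?thesis using A(2) by (simp add: count_upto_def)
  qed
  moreover have "0 \<notin> A" using A(1) by auto
  ultimately show "g \<in> lattice_paths k N"
    by (auto simp: lattice_paths_def A(3) count_upto_0 count_upto_Suc)
next
  fix g assume g: "g \<in> lattice_paths k N"
  define A where "A = {j. 1 \<le> j \<and> g j \<noteq> g (j - 1)}"
  have "count_upto A j = g j" for j
  proof (induction j)
    case 0
    then show ?case using g by (simp add: count_upto_0 A_def lattice_paths_def)
  next
    case (Suc j)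
    have "g j \<le> g (Suc j)" "g (Suc j) \<le> Suc (g j)" using g by (auto simp: lattice_paths_def)
    then show ?case using Suc by (auto simp: count_upto_Suc A_def)
  qed
  then have count: "count_upto A = g" by blast
  have A: "A \<subseteq> {1..N}"
  proof
    fix j assume "j \<in> A"
    then have "1 \<le> j" "g j \<noteq> g (j - 1)" by (auto simp: A_def)
    moreover have "g j = g (j - 1)" if "N < j" using g that by (simp add: lattice_paths_def)
    ultimately show "j \<in> {1..N}" by (cases "N < j") auto
  qed
  have "{a \<in> A. a \<le> N} = A" using A by auto
  then have "card A = count_upto A N" by (simp add: count_upto_def)
  also have "\<dots> = k" using g by (simp add: count lattice_paths_def)
  finally show "g \<in> count_upto ` {A. A \<subseteq> {1..N} \<and> card A = k}" using A count by blast
qed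

lemma bij_betw_chain_preimage:
  "bij_betw (\<lambda>A. {i \<in> {1..N}. chain N i \<in> A})
     {A. A \<subseteq> {1..N} \<and> card A = k} {A. A \<subseteq> {1..N} \<and> card A = k}"
proof (rule bij_betw_byWitness[where f' = "(`) (chain N)"])
  have inj: "inj_on (chain N) {1..N}" and surj: "chain N ` {1..N} = {1..N}"
    using bij_betw_chain by (auto simp: bij_betw_def)
  have image: "chain N ` {i \<in> {1..N}. chain N i \<in> A} = A" if "A \<subseteq> {1..N}" for A
  proof (intro equalityI subsetI)
    fix a assume a: "a \<in> A"
    then obtain i where "i \<in> {1..N}" "chain N i = a" using surj \<open>A \<subseteq> {1..N}\<close> by (metis imageE subsetD)
    then show "a \<in> chain N ` {i \<in> {1..N}. chain N i \<in> A}" using a by blast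
  qed blast
  have preimage: "{i \<in> {1..N}. chain N i \<in> chain N ` A} = A" if "A \<subseteq> {1..N}" for A
    using inj that by (auto dest: inj_onD)
  show "\<forall>A\<in>{A. A \<subseteq> {1..N} \<and> card A = k}. chain N ` {i \<in> {1..N}. chain N i \<in> A} = A"
    using image by blast
  show "\<forall>A\<in>{A. A \<subseteq> {1..N} \<and> card A = k}. {i \<in> {1..N}. chain N i \<in> chain N ` A} = A"
    using preimage by blast
  have card_image: "card (chain N ` A) = card A" if "A \<subseteq> {1..N}" for A
    using inj_on_subset[OF inj that] by (rule card_image)
  show "(\<lambda>A. {i \<in> {1..N}. chain N i \<in> A}) ` {A. A \<subseteq> {1..N} \<and> card A = k}
      \<subseteq> {A. A \<subseteq> {1..N} \<and> card A = k}"
  proof (rule image_subsetI)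
    fix A assume "A \<in> {A. A \<subseteq> {1..N} \<and> card A = k}"
    then show "{i \<in> {1..N}. chain N i \<in> A} \<in> {A. A \<subseteq> {1..N} \<and> card A = k}"
      using card_image[of "{i \<in> {1..N}. chain N i \<in> A}"] image[of A] by force
  qed
  show "(`) (chain N) ` {A. A \<subseteq> {1..N} \<and> card A = k} \<subseteq> {A. A \<subseteq> {1..N} \<and> card A = k}"
  proof (rule image_subsetI)
    fix A assume A: "A \<in> {A. A \<subseteq> {1..N} \<and> card A = k}"
    then have "chain N ` A \<subseteq> {1..N}" using surj by (metis image_mono mem_Collect_eq)
    then show "chain N ` A \<in> {A. A \<subseteq> {1..N} \<and> card A = k}" using A card_image[of A] by auto
  qed
qed

lemma bij_betw_height:
  assumes "k \<le> N"
  shows "bij_betw (height k N) (board_partitions k N) (lattice_paths k N)"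
proof -
  have "height k N = count_upto \<circ> ((\<lambda>A. {i \<in> {1..N}. chain N i \<in> A}) \<circ> S_set k)"
    by (simp add: height_def fun_eq_iff)
  then show ?thesis
    using bij_betw_trans[OF bij_betw_trans[OF bij_betw_S_set[OF assms] bij_betw_chain_preimage]
        bij_betw_count_upto] by simp
qed

lemma replaces_chain_iff:
  assumes "A \<subseteq> {1..N}" "B \<subseteq> {1..N}" "i \<in> {1..N}" "j \<in> {1..N}"
  shows "replaces (chain N j) (chain N i) A B \<longleftrightarrow>
    replaces j i {m \<in> {1..N}. chain N m \<in> A} {m \<in> {1..N}. chain N m \<in> B}" (is "?l \<longleftrightarrow> ?r")
proof -
  have inj: "inj_on (chain N) {1..N}" and surj: "chain N ` {1..N} = {1..N}"
    using bij_betw_chain by (auto simp: bij_betw_def)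
  have eq: "chain N m = chain N n \<longleftrightarrow> m = n" if "m \<in> {1..N}" "n \<in> {1..N}" for m n
    using inj that by (auto dest: inj_onD)
  have range: "chain N m \<in> {1..N}" if "m \<in> {1..N}" for m using surj that by blast
  have "B = insert (chain N i) (A - {chain N j}) \<longleftrightarrow>
      (\<forall>b\<in>{1..N}. b \<in> B \<longleftrightarrow> b = chain N i \<or> b \<in> A \<and> b \<noteq> chain N j)"
    using assms range[of i] by blast
  also have "\<dots> \<longleftrightarrow>
      (\<forall>m\<in>{1..N}. chain N m \<in> B \<longleftrightarrow> chain N m = chain N i \<or> chain N m \<in> A \<and> chain N m \<noteq> chain N j)"
    by (subst surj[symmetric]) (simp only: ball_simps)
  also have "\<dots> \<longleftrightarrow> (\<forall>m\<in>{1..N}. chain N m \<in> B \<longleftrightarrow> m = i \<or> chain N m \<in> A \<and> m \<noteq> j)"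
    using eq assms by simp
  also have "\<dots> \<longleftrightarrow> {m \<in> {1..N}. chain N m \<in> B} = insert i ({m \<in> {1..N}. chain N m \<in> A} - {j})"
    using assms by blast
  finally show ?thesis using assms by (simp add: replaces_def)
qed

text \<open>  The range \<open>1 \<le> i \<le> N - 1\<close> of the colors is implied on the right-hand side: all lattice paths agree
  at 0 and from \<open>N\<close> on, so no raise is possible there.\<close>

lemma domino_color_iff_raise:
  assumes \<sigma>: "\<sigma> \<in> board_partitions k N" and \<tau>: "\<tau> \<in> board_partitions k N" and kN: "k \<le> N"
  shows "domino_color k N \<sigma> \<tau> i \<longleftrightarrow> height k N \<tau> = raise i (height k N \<sigma>)"
proof -
  have paths: "height k N \<sigma> \<in> lattice_paths k N" "height k N \<tau> \<in> lattice_paths k N"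
    using bij_betw_height[OF kN] \<sigma> \<tau> by (auto simp: bij_betw_def)
  have raise: "height k N \<tau> = raise i (height k N \<sigma>) \<longleftrightarrow>
      (\<forall>m. height k N \<tau> m = height k N \<sigma> m + of_bool (i \<le> m \<and> m < i + 1))"
  proof -
    have "raise i g m = g m + of_bool (i \<le> m \<and> m < i + 1)" for g m
      by (cases "m = i") (simp_all add: raise_def)
    then show ?thesis by (simp only: fun_eq_iff)
  qed
  have color: "domino_color k N \<sigma> \<tau> i \<longleftrightarrow>
      i \<in> {1..N - 1} \<and> (\<forall>m. height k N \<tau> m = height k N \<sigma> m + of_bool (i \<le> m \<and> m < i + 1))"
    unfolding height_def replaces_iff_count_upto[OF less_add_one, symmetric] domino_color_iff_replaces
  proof (rule conj_cong[OF refl])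
    assume "i \<in> {1..N - 1}"
    then have "i \<in> {1..N}" "i + 1 \<in> {1..N}" by auto
    then show "replaces (chain N (i + 1)) (chain N i) (S_set k \<sigma>) (S_set k \<tau>) \<longleftrightarrow>
        replaces (i + 1) i {m \<in> {1..N}. chain N m \<in> S_set k \<sigma>} {m \<in> {1..N}. chain N m \<in> S_set k \<tau>}"
      by (rule replaces_chain_iff[OF S_set_subset[OF \<sigma> kN] S_set_subset[OF \<tau> kN]])
  qed
  have "i \<in> {1..N - 1}" if "height k N \<tau> = raise i (height k N \<sigma>)"
  proof -
    have "height k N \<tau> i \<noteq> height k N \<sigma> i" using that by (simp add: raise_def)
    moreover have "height k N \<tau> 0 = height k N \<sigma> 0" "N \<le> i \<Longrightarrow> height k N \<tau> i = height k N \<sigma> i"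
      using paths by (simp_all add: lattice_paths_def)
    ultimately have "i \<noteq> 0" "\<not> N \<le> i" by metis+
    then show ?thesis by auto
  qed
  then show ?thesis using color raise by blast
qed

lemma finite_board_partitions: "finite (board_partitions k N)"
  by (rule finite_subset[OF _ finite_lists_length_eq[of "{..N - k}" k]])
    (auto simp: board_partitions_def)

section \<open>The domino digraph as an order diagram\<close>

theorem mainTheorem1:
  fixes k N :: nat
  assumes "1 \<le> k" and "k \<le> N - 1"
  shows "edge_colored_by (domino_digraph k N) {1..N - 1} \<and>
         diamond_colored (domino_digraph k N) \<and>
         (\<exists>L :: nat list gorder. distributive_lattice L \<and> finite (carrier L) \<and>
            is_order_diagram_of (domino_digraph k N) L)"
proof -
  let ?G = "domino_digraph k N" and ?V = "board_partitions k N" and ?h = "height k N"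
  let ?L = "\<lparr>carrier = ?V, eq = (=), le = \<lambda>x y. ?h x \<le> ?h y\<rparr>"
  have kN: "1 \<le> k" "k < N" "k \<le> N" using assms by auto
  note bij = bij_betw_height[OF kN(3)]
  have color: "has_color ?G x y i \<longleftrightarrow> ?h y = raise i (?h x)" if "x \<in> ?V" "y \<in> ?V" for x y i
    using domino_color_iff_raise[OF that kN(3)] by (simp add: domino_digraph_def)
  have edge: "(x, y) \<in> edges ?G \<longleftrightarrow> x \<in> ?V \<and> y \<in> ?V \<and> (\<exists>i. ?h y = raise i (?h x))" for x y
    using edge_iff_domino_color[OF _ _ kN(1,2)] domino_color_iff_raise[OF _ _ kN(3)]
    by (auto simp: domino_digraph_def)
  have "edge_colored_by ?G {1..N - 1}"
    unfolding edge_colored_by_def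
  proof (intro conjI)
    show "edges ?G \<subseteq> vertices ?G \<times> vertices ?G" by (auto simp: domino_digraph_def)
    show "\<forall>(x, y)\<in>edges ?G. \<exists>i\<in>{1..N - 1}. \<forall>j. has_color ?G x y j \<longleftrightarrow> j = i"
    proof clarify
      fix x y assume "(x, y) \<in> edges ?G"
      then obtain i where xy: "x \<in> ?V" "y \<in> ?V" and i: "?h y = raise i (?h x)"
        unfolding edge by blast
      have "i \<in> {1..N - 1}"
        using i domino_color_iff_raise[OF xy kN(3), of i] by (simp add: domino_color_def)
      then show "\<exists>i\<in>{1..N - 1}. \<forall>j. has_color ?G x y j \<longleftrightarrow> j = i"
        using color[OF xy] i raise_index_unique by metis
    qed
  qed
  moreover have "diamond_colored ?G"
    unfolding diamond_colored_def
  proof (intro allI impI, elim conjE)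
    fix v s t u
    assume e: "(v, s) \<in> edges ?G" "(v, t) \<in> edges ?G" "(s, u) \<in> edges ?G" "(t, u) \<in> edges ?G"
      and "s \<noteq> t"
    obtain i j a b where "?h s = raise i (?h v)" "?h t = raise j (?h v)"
      "?h u = raise a (?h s)" "?h u = raise b (?h t)"
      using e unfolding edge by blast
    moreover have V: "v \<in> ?V" "s \<in> ?V" "t \<in> ?V" "u \<in> ?V" using e unfolding edge by blast+
    moreover have "?h s \<noteq> ?h t" using \<open>s \<noteq> t\<close> V bij by (auto simp: bij_betw_def dest: inj_onD)
    ultimately show "(\<forall>i. has_color ?G v s i \<longleftrightarrow> has_color ?G t u i) \<and>
        (\<forall>i. has_color ?G v t i \<longleftrightarrow> has_color ?G s u i)"
      using raise_diamond[of a i "?h v" b j] by (simp add: color) (metis raise_index_unique)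
  qed
  moreover have "distributive_lattice ?L"
    using bij lattice_paths_inf lattice_paths_sup
    by (intro distributive_lattice_of_embedding) (simp_all add: bij_betw_def)
  moreover have "is_order_diagram_of ?G ?L"
  proof -
    have "(x, y) \<in> edges ?G \<longleftrightarrow> covers ?L y x" for x y
      using covers_iff_raise[OF bij, of x y] unfolding edge by (auto simp: covers_def)
    then show ?thesis by (auto simp: is_order_diagram_of_def domino_digraph_def)
  qed
  ultimately show ?thesis using finite_board_partitions by (intro conjI exI[of _ ?L]) simp_all
qed

end
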